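(* Let $\mathcal E$ be a finite set of edge-colored graphs with the following properties: (1) the class of $\mathcal E$-free edge-colored graphs is closed under amalgamation over vertices: whenever $(G_1,\gamma_1)$ and $(G_2,\gamma_2)$ are $\mathcal E$-free and $v_1\in V(G_1)$, $v_2\in V(G_2)$, the edge-colored graph obtained from their disjoint union by identifying $v_1$ and $v_2$ is $\mathcal E$-free; (2) for every $K\ge 1$ there exists a finite graph $G$ that admits no $\mathcal E$-free edge-coloring, but every subgraph of $G$ with at most $K$ vertices admits an $\mathcal E$-free edge-coloring. Then there is no finite set $\mathcal F$ of vertex-colored graphs such that $\mathrm{Col}(\mathcal F)=\mathrm{Col}(\mathcal E)$, i.e., such that a finite graph admits an $\mathcal F$-free vertex-coloring if and only if it admits an $\mathcal E$-free edge-coloring.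
   Context: Graphs are finite simple undirected. Edge colors come from a fixed finite set. An edge-colored graph is $(G,\gamma)$ with $\gamma$ a map from $E(G)$ to the colors; $(G,\gamma)$ is $\mathcal E$-free if there is no $(E,\theta)\in\mathcal E$ and graph homomorphism $h\colon E\to G$ with $\gamma(h(e))=\theta(e)$ for all edges $e$ of $E$; an $\mathcal E$-free edge-coloring of $G$ is a $\gamma$ with $(G,\gamma)$ $\mathcal E$-free, and $\mathrm{Col}(\mathcal E)$ is the class/problem of finite graphs admitting one. Analogously, for a finite set $\mathcal F$ of vertex-colored graphs $(F,\phi)$ ($\phi$ maps vertices to a fixed finite set of colors), a vertex-coloring $\chi$ of $G$ is $\mathcal F$-free if no $(F,\phi)\in\mathcal F$ admits a homomorphism $h\colon F\to G$ with $\chi\circ h=\phi$; $\mathrm{Col}(\mathcal F)$ is the class of finite graphs admitting an $\mathcal F$-free vertex-coloring. *)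

theory Defs
  imports Main
begin

text \<open>Finite simple undirected graphs with vertices in nat (every finite graph is
isomorphic to one of these). A graph is a pair (V, E) of a vertex set and a set of
two-element edges.\<close>

type_synonym graph = "nat set \<times> nat set set"

definition verts :: "graph \<Rightarrow> nat set" where "verts G = fst G"
definition edges :: "graph \<Rightarrow> nat set set" where "edges G = snd G"

definition is_graph :: "graph \<Rightarrow> bool" where
  "is_graph G \<longleftrightarrow> finite (verts G) \<and>
     (\<forall>e\<in>edges G. \<exists>x y. x \<noteq> y \<and> e = {x, y} \<and> x \<in> verts G \<and> y \<in> verts G)"

definition is_hom :: "(nat \<Rightarrow> nat) \<Rightarrow> graph \<Rightarrow> graph \<Rightarrow> bool" where
  "is_hom h F G \<longleftrightarrow> (\<forall>x\<in>verts F. h x \<in> verts G) \<and>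
     (\<forall>x y. {x, y} \<in> edges F \<longrightarrow> {h x, h y} \<in> edges G)"

definition edge_free :: "(graph \<times> (nat set \<Rightarrow> 'c)) set \<Rightarrow> graph \<Rightarrow> (nat set \<Rightarrow> 'c) \<Rightarrow> bool" where
  "edge_free \<E> G \<gamma> \<longleftrightarrow> \<not> (\<exists>(H, \<theta>)\<in>\<E>. \<exists>h. is_hom h H G \<and>
      (\<forall>x y. {x, y} \<in> edges H \<longrightarrow> \<gamma> {h x, h y} = \<theta> {x, y}))"

definition ECol :: "(graph \<times> (nat set \<Rightarrow> 'c)) set \<Rightarrow> graph set" where
  "ECol \<E> = {G. is_graph G \<and> (\<exists>\<gamma>. edge_free \<E> G \<gamma>)}"

definition vertex_free :: "(graph \<times> (nat \<Rightarrow> 'd)) set \<Rightarrow> graph \<Rightarrow> (nat \<Rightarrow> 'd) \<Rightarrow> bool" where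
  "vertex_free \<F> G \<chi> \<longleftrightarrow> \<not> (\<exists>(H, \<phi>)\<in>\<F>. \<exists>h. is_hom h H G \<and>
      (\<forall>x\<in>verts H. \<chi> (h x) = \<phi> x))"

definition VCol :: "(graph \<times> (nat \<Rightarrow> 'd)) set \<Rightarrow> graph set" where
  "VCol \<F> = {G. is_graph G \<and> (\<exists>\<chi>. vertex_free \<F> G \<chi>)}"

definition is_subgraph :: "graph \<Rightarrow> graph \<Rightarrow> bool" where
  "is_subgraph H G \<longleftrightarrow> is_graph H \<and> verts H \<subseteq> verts G \<and> edges H \<subseteq> edges G"

text \<open>Amalgamation over a vertex: two graphs whose vertex sets meet in exactly one
vertex v, glued along v (this is the disjoint union with v1, v2 identified, up to
isomorphism). Since their edge sets are disjoint, a single coloring function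
encodes both colorings.\<close>
definition amalg_closed :: "(graph \<times> (nat set \<Rightarrow> 'c)) set \<Rightarrow> bool" where
  "amalg_closed \<E> \<longleftrightarrow> (\<forall>G1 G2 v \<gamma>. is_graph G1 \<and> is_graph G2 \<and>
      verts G1 \<inter> verts G2 = {v} \<and> edge_free \<E> G1 \<gamma> \<and> edge_free \<E> G2 \<gamma> \<longrightarrow>
      edge_free \<E> (verts G1 \<union> verts G2, edges G1 \<union> edges G2) \<gamma>)"

end

theory Submission
  imports Defs "HOL-Library.Cardinality" "HOL-Library.Nat_Bijection"
begin

text \<open>Suppose \<open>VCol \<F> = ECol \<E>\<close>, let \<open>K\<close> bound the sizes of the graphs in \<open>\<F>\<close>, and
let \<open>G\<close> be the graph that assumption (2) provides for \<open>K\<close>. Take a hypergraph that is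
partite with parts indexed by the vertices of \<open>G\<close>, in which any few hyperedges form a
Berge-acyclic family, and such that every vertex colouring has, for a suitable choice of one
colour per part, over every set \<open>S\<close> of at most \<open>K\<close> vertices of \<open>G\<close> a hyperedge coloured by the
chosen colours. Put a copy of \<open>G[S]\<close> on every hyperedge over \<open>S\<close>. The resulting graph has an
\<open>\<E>\<close>-free edge colouring, because a homomorphic image of a member of \<open>\<E>\<close> lies in few
hyperedges, so in an iterated amalgam over vertices of graphs \<open>G[S]\<close>. Hence it has an
\<open>\<F>\<close>-free vertex colouring, and the chosen colours of the parts are an \<open>\<F>\<close>-free vertex
colouring of \<open>G\<close>, a contradiction.

The hypergraphs come from the partite amalgamation of Nesetril and Rodl, by induction on the
number of hyperedges required to be acyclic.\<close>

section \<open>Sparse hypergraphs\<close>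

text \<open>These are the finite Berge-acyclic families. The inductive form mirrors iterated
  amalgamation over a vertex; inclusion in \<open>{v}\<close> also admits disjoint unions.\<close>

inductive hyperforest :: "'a set set \<Rightarrow> bool" where
  empty: "hyperforest {}"
| single: "hyperforest {e}"
| union: "hyperforest A \<Longrightarrow> hyperforest B \<Longrightarrow> A \<inter> B = {} \<Longrightarrow> \<Union>A \<inter> \<Union>B \<subseteq> {v} \<Longrightarrow> hyperforest (A \<union> B)"

lemma hyperforest_image:
  assumes "hyperforest A" "inj_on f (\<Union>A)"
  shows "hyperforest ((`) f ` A)"
  using assms
proof (induction)
  case empty
  then show ?case by (simp add: hyperforest.empty)
next
  case (single e)
  then show ?case by (simp add: hyperforest.single)
next
  case (union A B v)
  have inj: "inj_on f (\<Union>A \<union> \<Union>B)" using union.prems by simp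
  have "(`) f ` A \<inter> (`) f ` B = {}"
  proof (rule ccontr)
    assume "(`) f ` A \<inter> (`) f ` B \<noteq> {}"
    then obtain a b where ab: "a \<in> A" "b \<in> B" "f ` a = f ` b" by blast
    then have "a = b"
      using inj_on_image_eq_iff[OF inj, of a b] by blast
    then show False using ab union.hyps by blast
  qed
  moreover have "\<Union>((`) f ` A) \<inter> \<Union>((`) f ` B) = f ` (\<Union>A \<inter> \<Union>B)"
    using inj_on_image_Int[OF inj, of "\<Union>A" "\<Union>B"] by (simp add: image_Union)
  then have "\<Union>((`) f ` A) \<inter> \<Union>((`) f ` B) \<subseteq> {f v}"
    using union.hyps by blast
  moreover have "inj_on f (\<Union>A)" "inj_on f (\<Union>B)"
    using inj by (auto intro: inj_on_subset)
  ultimately show ?case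
    using union.IH by (auto simp: image_Un intro: hyperforest.union)
qed

text \<open>The members are joined only through \<open>Z\<close>, where each has at most one vertex,
  so adding one member at a time glues it at a single vertex.\<close>

lemma hyperforest_if_Int_subset:
  assumes "finite A"
    and "\<And>a b. a \<in> A \<Longrightarrow> b \<in> A \<Longrightarrow> a \<noteq> b \<Longrightarrow> a \<inter> b \<subseteq> Z"
    and "\<And>a. a \<in> A \<Longrightarrow> \<exists>v. a \<inter> Z \<subseteq> {v}"
  shows "hyperforest A"
  using assms
proof (induction A)
  case empty
  then show ?case by (simp add: hyperforest.empty)
next
  case (insert a A)
  obtain v where v: "a \<inter> Z \<subseteq> {v}" using insert.prems(2) by blast
  have "a \<inter> b \<subseteq> Z" if "b \<in> A" for b
    using insert.prems(1)[of a b] insert.hyps that by blast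
  then have "\<Union>{a} \<inter> \<Union>A \<subseteq> {v}" using v by blast
  moreover have "hyperforest A" using insert.prems by (intro insert.IH) auto
  ultimately have "hyperforest ({a} \<union> A)"
    using insert.hyps by (intro hyperforest.union hyperforest.single) auto
  then show ?case by simp
qed

text \<open>Forests are substituted for the members of a forest. A \<open>union\<close> step of the
  outer forest separates two groups of members by one vertex \<open>v\<close>, so the families put
  in their place meet at most in \<open>q v\<close>.\<close>

lemma hyperforest_UN:
  assumes "hyperforest B"
    and "\<And>M. M \<in> B \<Longrightarrow> hyperforest (\<A> M)"
    and "\<And>M N. M \<in> B \<Longrightarrow> N \<in> B \<Longrightarrow> M \<noteq> N \<Longrightarrow> \<A> M \<inter> \<A> N = {}"
    and "\<And>M N. M \<in> B \<Longrightarrow> N \<in> B \<Longrightarrow> M \<noteq> N \<Longrightarrow> \<Union>(\<A> M) \<inter> \<Union>(\<A> N) \<subseteq> q ` (M \<inter> N)"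
  shows "hyperforest (\<Union>M\<in>B. \<A> M)"
  using assms
proof (induction)
  case empty
  then show ?case by (simp add: hyperforest.empty)
next
  case (single e)
  then show ?case by simp
next
  case (union B C v)
  have ne: "M \<noteq> N" if "M \<in> B" "N \<in> C" for M N using that union.hyps by blast
  have "\<A> M \<inter> \<A> N = {}" if "M \<in> B" "N \<in> C" for M N
    using union.prems(2)[of M N] ne that by blast
  then have 1: "(\<Union>M\<in>B. \<A> M) \<inter> (\<Union>M\<in>C. \<A> M) = {}" by blast
  have "\<Union>(\<A> M) \<inter> \<Union>(\<A> N) \<subseteq> {q v}" if "M \<in> B" "N \<in> C" for M N
  proof -
    have "M \<inter> N \<subseteq> {v}" using that union.hyps by blast
    then show ?thesis using union.prems(3)[of M N] ne that by blast
  qed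
  then have 2: "\<Union>(\<Union>M\<in>B. \<A> M) \<inter> \<Union>(\<Union>M\<in>C. \<A> M) \<subseteq> {q v}" by blast
  have "hyperforest (\<Union>M\<in>B. \<A> M)"
    by (rule union.IH(1)) (simp_all add: union.prems)
  moreover have "hyperforest (\<Union>M\<in>C. \<A> M)"
    by (rule union.IH(2)) (simp_all add: union.prems)
  ultimately have "hyperforest ((\<Union>M\<in>B. \<A> M) \<union> (\<Union>M\<in>C. \<A> M))"
    using 1 2 by (rule hyperforest.union)
  then show ?case by simp
qed

text \<open>Distinct members get separated by some \<open>union\<close> step. Later this makes the
  hyperedge containing a given graph edge unique.\<close>

lemma hyperforest_Int_subset_singleton:
  assumes "hyperforest A" "a \<in> A" "b \<in> A" "a \<noteq> b"
  shows "\<exists>v. a \<inter> b \<subseteq> {v}"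
  using assms
proof (induction)
  case (union A B v)
  consider "a \<in> A" "b \<in> A" | "a \<in> B" "b \<in> B" | "a \<in> A" "b \<in> B" | "a \<in> B" "b \<in> A"
    using union.prems by blast
  then show ?case
  proof cases
    case 3
    then have "a \<inter> b \<subseteq> {v}" using union.hyps(4) by blast
    then show ?thesis by blast
  next
    case 4
    then have "a \<inter> b \<subseteq> {v}" using union.hyps(4) by blast
    then show ?thesis by blast
  qed (use union.IH union.prems in simp_all)
qed auto

section \<open>Ramsey hypergraphs of large Berge girth\<close>

definition sparse :: "nat \<Rightarrow> 'a set set \<Rightarrow> bool" where
  "sparse g \<H> \<longleftrightarrow> (\<forall>A\<subseteq>\<H>. finite A \<and> card A \<le> g \<longrightarrow> hyperforest A)"

text \<open>\<open>\<pi>\<close> maps a vertex to the index of its part. Only the vertices in parts with index in \<open>J\<close>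
are required to get the colour \<open>c\<close> of their part.\<close>

definition partite_ramsey ::
  "'d itself \<Rightarrow> nat \<Rightarrow> nat set set \<Rightarrow> nat set \<Rightarrow> (nat \<Rightarrow> nat) \<Rightarrow> nat set set \<Rightarrow> bool" where
  "partite_ramsey _ g \<S> J \<pi> \<H> \<longleftrightarrow> finite \<H> \<and> sparse g \<H> \<and>
     (\<forall>e\<in>\<H>. finite e \<and> inj_on \<pi> e \<and> \<pi> ` e \<in> \<S>) \<and>
     (\<forall>\<chi> :: nat \<Rightarrow> 'd. \<exists>c. \<forall>S\<in>\<S>. \<exists>e\<in>\<H>. \<pi> ` e = S \<and> (\<forall>x\<in>e. \<pi> x \<in> J \<longrightarrow> \<chi> x = c (\<pi> x)))"

definition uniform_ramsey :: "'d itself \<Rightarrow> nat \<Rightarrow> nat \<Rightarrow> nat set set \<Rightarrow> bool" where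
  "uniform_ramsey _ g k \<H> \<longleftrightarrow> finite \<H> \<and> sparse g \<H> \<and> (\<forall>e\<in>\<H>. finite e \<and> card e = k) \<and>
     (\<forall>\<chi> :: nat \<Rightarrow> 'd. \<exists>e\<in>\<H>. \<exists>c. \<forall>x\<in>e. \<chi> x = c)"

lemma monochromatic_subset:
  fixes c :: "nat \<Rightarrow> 'd::finite"
  shows "\<exists>S d. S \<subseteq> {..<k * CARD('d)} \<and> card S = k \<and> (\<forall>i\<in>S. c i = d)"
proof -
  let ?I = "{..<k * CARD('d)}"
  let ?X = "\<lambda>d. {i \<in> ?I. c i = d}"
  have "\<exists>d. k \<le> card (?X d)"
  proof (rule ccontr)
    assume "\<not> ?thesis"
    then have "card (?X d) < k" for d by (simp add: not_le)
    then have "(\<Sum>d\<in>(UNIV::'d set). card (?X d)) < (\<Sum>d\<in>(UNIV::'d set). k)"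
      by (intro sum_strict_mono) auto
    also have "\<dots> = card ?I" by simp
    also have "\<dots> = card (\<Union>d\<in>UNIV. ?X d)" by (rule arg_cong[where f = card]) auto
    also have "\<dots> = (\<Sum>d\<in>UNIV. card (?X d))" by (rule card_UN_disjoint) auto
    finally show False by simp
  qed
  then obtain d where "k \<le> card (?X d)" by blast
  then obtain S where S: "S \<subseteq> ?X d" "card S = k" by (meson obtain_subset_with_card_n)
  show ?thesis by (intro exI[of _ S] exI[of _ d]) (use S in auto)
qed

text \<open>The part colours \<open>c\<close> colour \<open>k * CARD('d)\<close> indices, so by
  pigeonhole \<open>k\<close> parts share a colour. These parts form a member of
  \<open>\<S>\<close>, and the hyperedge provided over it is monochromatic.\<close>

lemma uniform_ramsey_if_partite_ramsey:
  fixes k :: nat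
  defines "\<S> \<equiv> {S. S \<subseteq> {..<k * CARD('d::finite)} \<and> card S = k}"
  assumes "partite_ramsey TYPE('d) g \<S> {..<k * CARD('d)} \<pi> \<H>"
  shows "uniform_ramsey TYPE('d) g k \<H>"
proof -
  have edge: "finite e \<and> inj_on \<pi> e \<and> \<pi> ` e \<in> \<S>" if "e \<in> \<H>" for e
    using assms(2) that by (simp add: partite_ramsey_def)
  have "card e = k" if "e \<in> \<H>" for e
    using edge[OF that] card_image[of \<pi> e] by (simp add: \<S>_def)
  moreover have "\<exists>e\<in>\<H>. \<exists>d. \<forall>x\<in>e. \<chi> x = d" for \<chi> :: "nat \<Rightarrow> 'd"
  proof -
    have "\<exists>c. \<forall>S\<in>\<S>. \<exists>e\<in>\<H>. \<pi> ` e = S \<and> (\<forall>x\<in>e. \<pi> x \<in> {..<k * CARD('d)} \<longrightarrow> \<chi> x = c (\<pi> x))"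
      using assms(2) by (simp only: partite_ramsey_def)
    then obtain c where c: "\<forall>S\<in>\<S>. \<exists>e\<in>\<H>. \<pi> ` e = S \<and>
        (\<forall>x\<in>e. \<pi> x \<in> {..<k * CARD('d)} \<longrightarrow> \<chi> x = c (\<pi> x))" ..
    obtain S d where S: "S \<subseteq> {..<k * CARD('d)}" "card S = k" "\<forall>i\<in>S. c i = d"
      using monochromatic_subset[of k c] by auto
    then have "S \<in> \<S>" by (simp add: \<S>_def)
    from bspec[OF c this] obtain e where e: "e \<in> \<H>" "\<pi> ` e = S"
        "\<forall>x\<in>e. \<pi> x \<in> {..<k * CARD('d)} \<longrightarrow> \<chi> x = c (\<pi> x)" by auto
    have "\<chi> x = d" if "x \<in> e" for x
    proof -
      have "\<pi> x \<in> S" using imageI[OF that, of \<pi>] by (simp only: e(2))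
      then show ?thesis using S e(3) that by auto
    qed
    then show ?thesis using e(1) by (intro bexI[of _ e] exI[of _ d] ballI)
  qed
  ultimately show ?thesis
    using assms(2) by (simp add: partite_ramsey_def uniform_ramsey_def)
qed

text \<open>With no part constrained, one hyperedge over each member of \<open>\<S>\<close> is
  enough, and taking them pairwise disjoint excludes all cycles.\<close>

lemma partite_ramsey_empty:
  assumes "finite \<S>" "\<forall>S\<in>\<S>. finite S"
  shows "\<exists>\<pi> \<H>. partite_ramsey TYPE('d) g \<S> {} \<pi> \<H>"
proof -
  define copy where "copy S = (\<lambda>i. prod_encode (set_encode S, i)) ` S" for S :: "nat set"
  define \<pi> where "\<pi> x = snd (prod_decode x)" for x
  have disj: "a \<inter> b \<subseteq> {}" if ab: "a \<in> copy ` \<S>" "b \<in> copy ` \<S>" "a \<noteq> b" for a b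
  proof -
    obtain S T where ST: "S \<in> \<S>" "T \<in> \<S>" "a = copy S" "b = copy T" "S \<noteq> T" using ab by blast
    then have "set_encode S \<noteq> set_encode T" using assms(2) by (simp add: set_encode_eq)
    then show ?thesis using ST by (auto simp: copy_def)
  qed
  have forest: "hyperforest A" if "finite A" "A \<subseteq> copy ` \<S>" for A
  proof (rule hyperforest_if_Int_subset[OF that(1)])
    show "a \<inter> b \<subseteq> {}" if "a \<in> A" "b \<in> A" "a \<noteq> b" for a b
      using that \<open>A \<subseteq> copy ` \<S>\<close> by (intro disj) auto
  qed simp
  have \<pi>: "\<pi> ` copy S = S" for S by (force simp: \<pi>_def copy_def)
  have "partite_ramsey TYPE('d) g \<S> {} \<pi> (copy ` \<S>)"
    unfolding partite_ramsey_def
  proof (intro conjI ballI allI)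
    show "sparse g (copy ` \<S>)" using forest by (simp add: sparse_def)
    show "\<exists>c. \<forall>S\<in>\<S>. \<exists>e\<in>copy ` \<S>. \<pi> ` e = S \<and> (\<forall>x\<in>e. \<pi> x \<in> {} \<longrightarrow> \<chi> x = c (\<pi> x))"
      for \<chi> :: "nat \<Rightarrow> 'd" by (simp add: \<pi>)
    show "\<pi> ` e \<in> \<S>" if "e \<in> copy ` \<S>" for e using that \<pi> by auto
    show "finite e" if "e \<in> copy ` \<S>" for e using that assms(2) by (auto simp: copy_def)
    show "inj_on \<pi> e" if "e \<in> copy ` \<S>" for e using that by (auto simp: copy_def \<pi>_def inj_on_def)
    show "finite (copy ` \<S>)" using assms(1) by simp
  qed
  then show ?thesis by blast
qed

text \<open>Every hyperedge \<open>M\<close> of a sparse uniform hypergraph carries a copy of \<open>\<H>\<close> whose part \<open>j\<close>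
is \<open>M\<close>; the copies are disjoint outside part \<open>j\<close>. Vertices of part \<open>j\<close> are encoded with
first component \<open>0\<close>, the other ones with the code of their copy.\<close>

lemma partite_ramsey_insert:
  assumes uniform: "\<And>k. \<exists>\<M>. uniform_ramsey TYPE('d) g k \<M>"
    and partite: "partite_ramsey TYPE('d) (Suc g) \<S> J \<pi> \<H>"
  shows "\<exists>\<pi>' \<H>'. partite_ramsey TYPE('d) (Suc g) \<S> (insert j J) \<pi>' \<H>'"
proof -
  have fin: "finite \<H>" and sparse: "sparse (Suc g) \<H>"
    and edge: "\<And>e. e \<in> \<H> \<Longrightarrow> finite e \<and> inj_on \<pi> e \<and> \<pi> ` e \<in> \<S>"
    and ramsey: "\<And>\<chi> :: nat \<Rightarrow> 'd. \<exists>c. \<forall>S\<in>\<S>. \<exists>e\<in>\<H>. \<pi> ` e = S \<and> (\<forall>x\<in>e. \<pi> x \<in> J \<longrightarrow> \<chi> x = c (\<pi> x))"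
    using partite by (auto simp: partite_ramsey_def)
  define W where "W = {x \<in> \<Union>\<H>. \<pi> x = j}"
  have finW: "finite W" using fin edge by (auto simp: W_def)
  \<comment> \<open>Uniformity \<open>card W\<close> allows each hyperedge of \<open>\<M>\<close> to
    be identified with \<open>W\<close>, the part \<open>j\<close> of \<open>\<H>\<close>.\<close>
  obtain \<M> where "uniform_ramsey TYPE('d) g (card W) \<M>" using uniform by blast
  then have finM: "finite \<M>" and sparseM: "sparse g \<M>"
    and edgeM: "\<And>M. M \<in> \<M> \<Longrightarrow> finite M \<and> card M = card W"
    and ramseyM: "\<And>\<chi> :: nat \<Rightarrow> 'd. \<exists>M\<in>\<M>. \<exists>c. \<forall>x\<in>M. \<chi> x = c"
    by (auto simp: uniform_ramsey_def)
  have "\<exists>b. bij_betw b W M" if "M \<in> \<M>" for M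
    using edgeM[OF that] finW by (metis finite_same_card_bij)
  then obtain b where b: "\<And>M. M \<in> \<M> \<Longrightarrow> bij_betw (b M) W M" by metis
  define f where "f M x = (if \<pi> x = j then prod_encode (0, b M x)
      else prod_encode (Suc (set_encode M), x))" for M x
  define \<pi>' where "\<pi>' y = (case prod_decode y of (n, x) \<Rightarrow> if n = 0 then j else \<pi> x)" for y
  define \<H>' where "\<H>' = (\<Union>M\<in>\<M>. (`) (f M) ` \<H>)"
  have \<pi>'_f: "\<pi>' (f M x) = \<pi> x" for M x by (simp add: f_def \<pi>'_def)
  have inj_f: "inj_on (f M) (\<Union>\<H>)" if "M \<in> \<M>" for M
  proof (rule inj_onI)
    fix x y assume xy: "x \<in> \<Union>\<H>" "y \<in> \<Union>\<H>" "f M x = f M y"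
    then have "\<pi> x = \<pi> y" by (metis \<pi>'_f)
    then show "x = y"
      using xy b[OF that] by (auto simp: f_def W_def bij_betw_def inj_on_def split: if_splits)
  qed
  define Z where "Z = range (\<lambda>x. prod_encode (0, x))"
  have Int_f: "f M ` a \<inter> f N ` c \<subseteq> (\<lambda>x. prod_encode (0, x)) ` (M \<inter> N)"
    if MN: "M \<in> \<M>" "N \<in> \<M>" "M \<noteq> N" and ac: "a \<in> \<H>" "c \<in> \<H>" for M N a c
  proof
    fix y assume "y \<in> f M ` a \<inter> f N ` c"
    then obtain x z where xz: "x \<in> a" "z \<in> c" "y = f M x" "y = f N z" by blast
    have "set_encode M \<noteq> set_encode N" using MN edgeM by (simp add: set_encode_eq)
    then have "\<pi> x = j" "\<pi> z = j" "b M x = b N z" using xz by (auto simp: f_def split: if_splits)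
    moreover have "x \<in> W" "z \<in> W" using calculation xz ac by (auto simp: W_def)
    then have "b M x \<in> M" "b N z \<in> N" using b MN by (auto simp: bij_betw_def)
    ultimately show "y \<in> (\<lambda>x. prod_encode (0, x)) ` (M \<inter> N)" using xz by (auto simp: f_def)
  qed
  \<comment> \<open>Hyperedges are transversal to the parts, so each of them meets part
    \<open>j\<close> at most once.\<close>
  have part: "\<exists>v. f M ` e \<inter> Z \<subseteq> {v}" if "e \<in> \<H>" for M e
  proof -
    have *: "x = y" if "x \<in> e" "y \<in> e" "f M x \<in> Z" "f M y \<in> Z" for x y
    proof -
      have "\<pi> x = j" "\<pi> y = j" using that by (auto simp: f_def Z_def split: if_splits)
      then show ?thesis using edge[OF \<open>e \<in> \<H>\<close>] that by (auto simp: inj_on_def)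
    qed
    show ?thesis
    proof (cases "f M ` e \<inter> Z = {}")
      case False
      then obtain x where "x \<in> e" "f M x \<in> Z" by blast
      then have "f M ` e \<inter> Z \<subseteq> {f M x}" using * by blast
      then show ?thesis by blast
    qed blast
  qed
  have forest: "hyperforest A" if A: "A \<subseteq> \<H>'" "finite A" "card A \<le> Suc g" for A
  proof -
    have "\<forall>a\<in>A. \<exists>M e. M \<in> \<M> \<and> e \<in> \<H> \<and> a = f M ` e" using A(1) unfolding \<H>'_def by blast
    then obtain m \<epsilon> where m: "\<And>a. a \<in> A \<Longrightarrow> m a \<in> \<M>" "\<And>a. a \<in> A \<Longrightarrow> \<epsilon> a \<in> \<H>"
        "\<And>a. a \<in> A \<Longrightarrow> a = f (m a) ` \<epsilon> a" by metis
    \<comment> \<open>The girth grows by one here. If at most \<open>g\<close> copies are involved,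
      sparsity of \<open>\<M>\<close> makes them a forest, into which the forests inside the copies
      are substituted. Otherwise all \<open>Suc g\<close> members lie in different copies and meet
      only inside \<open>Z\<close>.\<close>
    show ?thesis
    proof (cases "card (m ` A) \<le> g")
      case True
      define \<A> where "\<A> M = {a \<in> A. m a = M}" for M
      have "hyperforest (m ` A)" using True A(2) m(1) sparseM
        unfolding sparse_def by (metis finite_imageI image_subsetI)
      then have "hyperforest (\<Union>M\<in>m ` A. \<A> M)"
      proof (rule hyperforest_UN)
        fix M assume "M \<in> m ` A"
        then have M: "M \<in> \<M>" using m by blast
        have "card (\<epsilon> ` \<A> M) \<le> card (\<A> M)" using A(2) by (intro card_image_le) (simp add: \<A>_def)
        also have "\<dots> \<le> card A" using A(2) by (intro card_mono) (auto simp: \<A>_def)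
        finally have "card (\<epsilon> ` \<A> M) \<le> Suc g" using A(3) by simp
        moreover have sub: "\<epsilon> ` \<A> M \<subseteq> \<H>" using m by (auto simp: \<A>_def)
        moreover have "finite (\<epsilon> ` \<A> M)" using A(2) by (simp add: \<A>_def)
        ultimately have "hyperforest (\<epsilon> ` \<A> M)" using sparse by (auto simp: sparse_def)
        moreover have "inj_on (f M) (\<Union>(\<epsilon> ` \<A> M))"
          using inj_f[OF M] sub by (meson Union_mono inj_on_subset)
        ultimately have "hyperforest ((`) (f M) ` \<epsilon> ` \<A> M)" by (rule hyperforest_image)
        moreover have "(`) (f M) ` \<epsilon> ` \<A> M = id ` \<A> M"
          unfolding image_image by (rule image_cong) (use m(3) in \<open>auto simp: \<A>_def\<close>)
        ultimately show "hyperforest (\<A> M)" by simp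
      next
        fix M N assume MN: "M \<in> m ` A" "N \<in> m ` A" "M \<noteq> N"
        show "\<A> M \<inter> \<A> N = {}" using MN by (auto simp: \<A>_def)
        have "a \<inter> c \<subseteq> (\<lambda>x. prod_encode (0, x)) ` (M \<inter> N)" if "a \<in> \<A> M" "c \<in> \<A> N" for a c
        proof -
          have ac: "a \<in> A" "c \<in> A" "m a = M" "m c = N" using that by (auto simp: \<A>_def)
          then show ?thesis
            using Int_f[of M N "\<epsilon> a" "\<epsilon> c"] m(1)[of a] m(1)[of c] m(2)[of a] m(2)[of c]
              m(3)[of a] m(3)[of c] MN(3) by simp
        qed
        then show "\<Union>(\<A> M) \<inter> \<Union>(\<A> N) \<subseteq> (\<lambda>x. prod_encode (0, x)) ` (M \<inter> N)" by blast
      qed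
      moreover have "(\<Union>M\<in>m ` A. \<A> M) = A" by (auto simp: \<A>_def)
      ultimately show ?thesis by simp
    next
      case False
      then have "card (m ` A) = card A" using card_image_le[OF A(2), of m] A(3) by linarith
      then have inj: "inj_on m A" using A(2) by (simp add: eq_card_imp_inj_on)
      show ?thesis
      proof (rule hyperforest_if_Int_subset[OF A(2)])
        fix a c assume ac: "a \<in> A" "c \<in> A" "a \<noteq> c"
        then have "m a \<noteq> m c" using inj by (auto simp: inj_on_def)
        then show "a \<inter> c \<subseteq> Z"
          using Int_f[of "m a" "m c" "\<epsilon> a" "\<epsilon> c"] m(1)[of a] m(1)[of c] m(2)[of a] m(2)[of c]
              m(3)[of a] m(3)[of c] ac by (auto simp: Z_def)
      next
        fix a assume "a \<in> A"
        then show "\<exists>v. a \<inter> Z \<subseteq> {v}" using part m by metis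
      qed
    qed
  qed
  have "partite_ramsey TYPE('d) (Suc g) \<S> (insert j J) \<pi>' \<H>'"
    unfolding partite_ramsey_def
  proof (intro conjI ballI allI)
    show "finite \<H>'" using fin finM by (simp add: \<H>'_def)
    show "sparse (Suc g) \<H>'" using forest by (simp add: sparse_def)
    show "finite e" if "e \<in> \<H>'" for e using that edge by (auto simp: \<H>'_def)
    show "inj_on \<pi>' e" if "e \<in> \<H>'" for e
      using that edge by (fastforce simp: \<H>'_def inj_on_def \<pi>'_f)
    show "\<pi>' ` e \<in> \<S>" if "e \<in> \<H>'" for e
      using that edge by (auto simp: \<H>'_def image_image \<pi>'_f)
    fix \<chi> :: "nat \<Rightarrow> 'd"
    \<comment> \<open>The order matters: first \<open>M\<close> is chosen so that part
      \<open>j\<close> of its copy is monochromatic, then the Ramsey property of \<open>\<H>\<close>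
      is applied inside this copy.\<close>
    obtain M d where M: "M \<in> \<M>" "\<forall>x\<in>M. \<chi> (prod_encode (0, x)) = d"
      using ramseyM[of "\<lambda>x. \<chi> (prod_encode (0, x))"] by auto
    obtain c where c: "\<forall>S\<in>\<S>. \<exists>e\<in>\<H>. \<pi> ` e = S \<and> (\<forall>x\<in>e. \<pi> x \<in> J \<longrightarrow> \<chi> (f M x) = c (\<pi> x))"
      using ramsey[of "\<lambda>x. \<chi> (f M x)"] ..
    have "\<exists>e\<in>\<H>'. \<pi>' ` e = S \<and> (\<forall>x\<in>e. \<pi>' x \<in> insert j J \<longrightarrow> \<chi> x = (c(j := d)) (\<pi>' x))"
      if "S \<in> \<S>" for S
    proof -
      obtain e where e: "e \<in> \<H>" "\<pi> ` e = S" "\<forall>x\<in>e. \<pi> x \<in> J \<longrightarrow> \<chi> (f M x) = c (\<pi> x)"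
        using bspec[OF c \<open>S \<in> \<S>\<close>] by auto
      have "\<chi> (f M x) = d" if "x \<in> e" "\<pi> x = j" for x
      proof -
        have "x \<in> W" using that e(1) by (auto simp: W_def)
        then have "b M x \<in> M" using b[OF M(1)] by (auto simp: bij_betw_def)
        then show ?thesis using M(2) that by (simp add: f_def)
      qed
      then have "\<forall>x\<in>f M ` e. \<pi>' x \<in> insert j J \<longrightarrow> \<chi> x = (c(j := d)) (\<pi>' x)"
        using e(3) by (auto simp: \<pi>'_f)
      moreover have "\<pi>' ` f M ` e = S" using e(2) by (simp add: image_image \<pi>'_f)
      moreover have "f M ` e \<in> \<H>'" using M(1) e(1) by (auto simp: \<H>'_def)
      ultimately show ?thesis by (intro bexI[of _ "f M ` e"] conjI)
    qed
    then show "\<exists>c. \<forall>S\<in>\<S>. \<exists>e\<in>\<H>'. \<pi>' ` e = S \<and>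
        (\<forall>x\<in>e. \<pi>' x \<in> insert j J \<longrightarrow> \<chi> x = c (\<pi>' x))"
      by (intro exI[of _ "c(j := d)"] ballI)
  qed
  then show ?thesis by blast
qed

text \<open>Outer induction on \<open>g\<close>, inner induction on the set of constrained parts.
  The statement for \<open>g\<close> yields the uniform hypergraphs with which, at
  \<open>Suc g\<close>, one part after another is constrained.\<close>

theorem partite_ramsey_exists:
  assumes "finite I" "\<S> \<subseteq> Pow I"
  shows "\<exists>\<pi> \<H>. partite_ramsey TYPE('d::finite) g \<S> I \<pi> \<H>"
  using assms
proof (induction g arbitrary: I \<S>)
  case 0
  \<comment> \<open>For \<open>g = 0\<close> only the empty family has to be a forest, so
    \<open>\<S>\<close> itself serves, with each colouring as its own choice of part
    colours.\<close>
  have "partite_ramsey TYPE('d) 0 \<S> I id \<S>"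
    using 0 finite_subset[of \<S> "Pow I"]
    by (auto simp: partite_ramsey_def sparse_def hyperforest.empty intro: finite_subset)
  then show ?case by blast
next
  case (Suc g)
  \<comment> \<open>The index set used here is unrelated to \<open>I\<close>, which is why the
    induction generalises over \<open>I\<close> and \<open>\<S>\<close>.\<close>
  have uniform: "\<exists>\<M>. uniform_ramsey TYPE('d) g k \<M>" for k
  proof -
    have "\<exists>\<pi> \<H>. partite_ramsey TYPE('d) g {S. S \<subseteq> {..<k * CARD('d)} \<and> card S = k}
        {..<k * CARD('d)} \<pi> \<H>"
      by (rule Suc.IH) auto
    then show ?thesis using uniform_ramsey_if_partite_ramsey by blast
  qed
  have "finite \<S>" "\<forall>S\<in>\<S>. finite S"
    using Suc.prems finite_subset[of \<S> "Pow I"] by (auto intro: finite_subset)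
  note base = partite_ramsey_empty[OF this]
  from Suc.prems(1) show ?case
  proof (induction I)
    case empty
    show ?case by (rule base)
  next
    case (insert j J)
    then show ?case using partite_ramsey_insert[OF uniform] by blast
  qed
qed

section \<open>Free edge colourings of amalgams\<close>

lemma is_graph_edge_verts:
  assumes "is_graph G" "{x, y} \<in> edges G"
  shows "x \<in> verts G" "y \<in> verts G"
proof -
  obtain a b where "{x, y} = {a, b}" "a \<in> verts G" "b \<in> verts G"
    using assms unfolding is_graph_def by meson
  then show "x \<in> verts G" "y \<in> verts G" by (auto simp: doubleton_eq_iff)
qed

text \<open>\<open>amalg_closed\<close> asks for exactly one common vertex. So a vertex
  \<open>v\<close> of \<open>G2\<close> is added to \<open>G1\<close> as an isolated vertex, which
  preserves freeness as \<open>G1\<close> is nonempty, and the gluing is done at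
  \<open>v\<close>.\<close>

lemma edge_free_disjoint_union:
  assumes "amalg_closed \<E>" "is_graph G1" "is_graph G2"
    and "edge_free \<E> G1 \<gamma>" "edge_free \<E> G2 \<gamma>" "verts G1 \<inter> verts G2 = {}"
  shows "edge_free \<E> (verts G1 \<union> verts G2, edges G1 \<union> edges G2) \<gamma>"
proof -
  have no_edges: "edges G = {}" if "is_graph G" "verts G = {}" for G
    using that by (auto simp: is_graph_def)
  have pair: "(verts G, edges G) = G" for G by (simp add: verts_def edges_def)
  consider "verts G1 = {}" | "verts G2 = {}" | u v where "u \<in> verts G1" "v \<in> verts G2" by blast
  then show ?thesis
  proof cases
    case 1
    then show ?thesis using no_edges[OF assms(2)] assms(5) by (simp add: pair)
  next
    case 2
    then show ?thesis using no_edges[OF assms(3)] assms(4) by (simp add: pair)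
  next
    case (3 u v)
    define G where "G = (insert v (verts G1), edges G1)"
    have G[simp]: "verts G = insert v (verts G1)" "edges G = edges G1"
      by (simp_all add: G_def verts_def edges_def)
    have "v \<notin> verts G1" using 3 assms(6) by blast
    have "edge_free \<E> G \<gamma>"
      unfolding edge_free_def
    proof clarify
      fix H \<theta> h
      assume H: "(H, \<theta>) \<in> \<E>" "is_hom h H G" "\<forall>x y. {x, y} \<in> edges H \<longrightarrow> \<gamma> {h x, h y} = \<theta> {x, y}"
      \<comment> \<open>Only isolated vertices of \<open>H\<close> are mapped to \<open>v\<close>, so they can be moved to \<open>u\<close>.\<close>
      define h' where "h' x = (if h x = v then u else h x)" for x
      have hE: "{h x, h y} \<in> edges G1 \<and> h' x = h x \<and> h' y = h y" if "{x, y} \<in> edges H" for x y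
      proof -
        have "{h x, h y} \<in> edges G1" using H(2) that by (simp add: is_hom_def)
        then show ?thesis using is_graph_edge_verts[OF assms(2), of "h x" "h y"] \<open>v \<notin> verts G1\<close> by (auto simp: h'_def)
      qed
      have "is_hom h' H G1"
        using H(2) hE 3(1) by (auto simp: is_hom_def h'_def)
      moreover have "\<forall>x y. {x, y} \<in> edges H \<longrightarrow> \<gamma> {h' x, h' y} = \<theta> {x, y}"
        using H(3) hE by auto
      ultimately show False using assms(4) H(1) unfolding edge_free_def by blast
    qed
    moreover have "is_graph G" using assms(2) by (fastforce simp: is_graph_def)
    moreover have "verts G \<inter> verts G2 = {v}" using 3 assms(6) by auto
    ultimately have "edge_free \<E> (verts G \<union> verts G2, edges G \<union> edges G2) \<gamma>"
      using assms(1,3,5) unfolding amalg_closed_def by blast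
    moreover have "verts G \<union> verts G2 = verts G1 \<union> verts G2" using 3 by auto
    ultimately show ?thesis by simp
  qed
qed

lemma edge_free_union:
  assumes "amalg_closed \<E>" "is_graph G1" "is_graph G2"
    and "edge_free \<E> G1 \<gamma>" "edge_free \<E> G2 \<gamma>" "verts G1 \<inter> verts G2 \<subseteq> {v}"
  shows "edge_free \<E> (verts G1 \<union> verts G2, edges G1 \<union> edges G2) \<gamma>"
proof (cases "verts G1 \<inter> verts G2 = {}")
  case True
  then show ?thesis using edge_free_disjoint_union assms by blast
next
  case False
  then have "verts G1 \<inter> verts G2 = {v}" using assms(6) by blast
  then show ?thesis using assms unfolding amalg_closed_def by blast
qed

section \<open>Copies of a graph placed on hyperedges\<close>

text \<open>Where \<open>\<pi>\<close> is injective on \<open>e\<close>, the condition on the image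
  of \<open>d\<close> forces \<open>d\<close> to have two elements if \<open>G\<close> is a graph,
  so no separate condition on \<open>d\<close> is stated.\<close>

definition pullback_graph :: "graph \<Rightarrow> (nat \<Rightarrow> nat) \<Rightarrow> nat set set \<Rightarrow> graph" where
  "pullback_graph G \<pi> A = (\<Union>A, {d. \<exists>e\<in>A. d \<subseteq> e \<and> \<pi> ` d \<in> edges G})"

lemma verts_pullback_graph[simp]: "verts (pullback_graph G \<pi> A) = \<Union>A"
  by (simp add: pullback_graph_def verts_def)

lemma edges_pullback_graph[simp]:
  "edges (pullback_graph G \<pi> A) = {d. \<exists>e\<in>A. d \<subseteq> e \<and> \<pi> ` d \<in> edges G}"
  by (simp add: pullback_graph_def edges_def)

lemma is_graph_finite_edges:
  assumes "is_graph G"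
  shows "finite (edges G)"
proof (rule finite_subset)
  show "edges G \<subseteq> Pow (verts G)" using assms by (fastforce simp: is_graph_def)
  show "finite (Pow (verts G))" using assms by (simp add: is_graph_def)
qed

lemma is_graph_pullback_graph:
  assumes "is_graph G" "finite A" "\<forall>e\<in>A. finite e \<and> inj_on \<pi> e"
  shows "is_graph (pullback_graph G \<pi> A)"
  unfolding is_graph_def
proof (intro conjI ballI)
  show "finite (verts (pullback_graph G \<pi> A))" using assms by simp
  fix d assume "d \<in> edges (pullback_graph G \<pi> A)"
  then obtain e where e: "e \<in> A" "d \<subseteq> e" "\<pi> ` d \<in> edges G" by auto
  have "inj_on \<pi> d" using assms(3) e by (meson inj_on_subset)
  then have "card d = card (\<pi> ` d)" by (simp add: card_image)
  also have "\<dots> = 2" using assms(1) e(3) unfolding is_graph_def by fastforce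
  finally obtain x y where "d = {x, y}" "x \<noteq> y" by (auto simp: card_2_iff)
  then show "\<exists>x y. x \<noteq> y \<and> d = {x, y} \<and> x \<in> verts (pullback_graph G \<pi> A) \<and>
      y \<in> verts (pullback_graph G \<pi> A)" using e by auto
qed

text \<open>Rule induction: a \<open>union\<close> step amalgamates the two pullback graphs over at
  most one vertex.\<close>

lemma edge_free_pullback_hyperforest:
  assumes "amalg_closed \<E>" "is_graph G" "edge_free \<E> ({}, {}) \<gamma>"
    and "hyperforest A" "finite A" "\<forall>e\<in>A. finite e \<and> inj_on \<pi> e"
    and "\<forall>e\<in>A. edge_free \<E> (pullback_graph G \<pi> {e}) \<gamma>"
  shows "edge_free \<E> (pullback_graph G \<pi> A) \<gamma>"
  using assms(4-)
proof (induction)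
  case empty
  then show ?case using assms(3) by (simp add: pullback_graph_def)
next
  case (single e)
  then show ?case by simp
next
  case (union A B v)
  let ?G = "pullback_graph G \<pi>"
  have "edge_free \<E> (verts (?G A) \<union> verts (?G B), edges (?G A) \<union> edges (?G B)) \<gamma>"
    using union assms(1,2) by (intro edge_free_union[where v = v] is_graph_pullback_graph) auto
  moreover have "(verts (?G A) \<union> verts (?G B), edges (?G A) \<union> edges (?G B)) = ?G (A \<union> B)"
    unfolding verts_pullback_graph edges_pullback_graph by (auto simp: pullback_graph_def)
  ultimately show ?case by simp
qed

text \<open>The image of a forbidden graph is covered by one hyperedge per vertex and per edge,
  hence by at most \<open>g\<close> of them, and these form a hyperforest.\<close>

lemma edge_free_pullback_sparse:
  assumes "amalg_closed \<E>" "is_graph G" "edge_free \<E> ({}, {}) \<gamma>"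
    and "\<forall>(H, \<theta>)\<in>\<E>. is_graph H \<and> card (verts H) + card (edges H) \<le> g"
    and "sparse g \<H>" "\<forall>e\<in>\<H>. finite e \<and> inj_on \<pi> e"
    and "\<forall>e\<in>\<H>. edge_free \<E> (pullback_graph G \<pi> {e}) \<gamma>"
  shows "edge_free \<E> (pullback_graph G \<pi> \<H>) \<gamma>"
  unfolding edge_free_def
proof clarify
  fix H \<theta> h
  assume H: "(H, \<theta>) \<in> \<E>" "is_hom h H (pullback_graph G \<pi> \<H>)"
    "\<forall>x y. {x, y} \<in> edges H \<longrightarrow> \<gamma> {h x, h y} = \<theta> {x, y}"
  have gH: "is_graph H" and le: "card (verts H) + card (edges H) \<le> g" using assms(4) H(1) by auto
  have fin: "finite (verts H)" "finite (edges H)"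
    using gH is_graph_finite_edges by (auto simp: is_graph_def)
  have "\<forall>x\<in>verts H. \<exists>e\<in>\<H>. h x \<in> e" using H(2) by (auto simp: is_hom_def)
  then obtain p where p: "\<And>x. x \<in> verts H \<Longrightarrow> p x \<in> \<H> \<and> h x \<in> p x" by metis
  have "\<forall>d\<in>edges H. \<exists>e\<in>\<H>. h ` d \<subseteq> e \<and> \<pi> ` h ` d \<in> edges G"
  proof
    fix d assume d: "d \<in> edges H"
    then obtain x y where xy: "d = {x, y}" using gH by (auto simp: is_graph_def)
    then have "{h x, h y} \<in> edges (pullback_graph G \<pi> \<H>)" using H(2) d by (simp add: is_hom_def)
    then show "\<exists>e\<in>\<H>. h ` d \<subseteq> e \<and> \<pi> ` h ` d \<in> edges G" using xy by auto
  qed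
  then obtain q where q: "\<And>d. d \<in> edges H \<Longrightarrow> q d \<in> \<H> \<and> h ` d \<subseteq> q d \<and> \<pi> ` h ` d \<in> edges G"
    by metis
  \<comment> \<open>The hyperedges chosen for vertices are included so that isolated vertices of
    \<open>H\<close> also stay inside the smaller graph.\<close>
  define A where "A = p ` verts H \<union> q ` edges H"
  have A: "A \<subseteq> \<H>" "finite A" using p q fin by (auto simp: A_def)
  have "card A \<le> card (p ` verts H) + card (q ` edges H)" unfolding A_def by (rule card_Un_le)
  also have "\<dots> \<le> g" using card_image_le[OF fin(1), of p] card_image_le[OF fin(2), of q] le by linarith
  finally have "hyperforest A" using A assms(5) by (simp add: sparse_def)
  then have "edge_free \<E> (pullback_graph G \<pi> A) \<gamma>"
    using A assms by (intro edge_free_pullback_hyperforest) auto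
  moreover have "is_hom h H (pullback_graph G \<pi> A)"
    unfolding is_hom_def
  proof (intro conjI ballI allI impI)
    show "h x \<in> verts (pullback_graph G \<pi> A)" if "x \<in> verts H" for x
      using p[OF that] that by (auto simp: A_def)
    show "{h x, h y} \<in> edges (pullback_graph G \<pi> A)" if "{x, y} \<in> edges H" for x y
      using q[OF that] that by (auto simp: A_def)
  qed
  ultimately show False using H(1,3) unfolding edge_free_def by blast
qed

text \<open>Every edge inherits its colour, through \<open>\<pi>\<close>, from a free colouring of
  the induced subgraph below the only hyperedge that contains it.\<close>

lemma pullback_sparse_in_ECol:
  assumes "amalg_closed \<E>" "is_graph G" "({}, {}) \<in> ECol \<E>"
    and bound: "\<forall>(H, \<theta>)\<in>\<E>. is_graph H \<and> card (verts H) + card (edges H) \<le> g" and "2 \<le> g"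
    and "finite \<H>" "sparse g \<H>" "\<forall>e\<in>\<H>. finite e \<and> inj_on \<pi> e"
    and col: "\<forall>e\<in>\<H>. (\<pi> ` e, {d \<in> edges G. d \<subseteq> \<pi> ` e}) \<in> ECol \<E>"
  shows "pullback_graph G \<pi> \<H> \<in> ECol \<E>"
proof -
  have "\<forall>e\<in>\<H>. \<exists>\<gamma>. edge_free \<E> (\<pi> ` e, {d \<in> edges G. d \<subseteq> \<pi> ` e}) \<gamma>"
    using col by (auto simp: ECol_def)
  then obtain \<Gamma> where \<Gamma>: "\<And>e. e \<in> \<H> \<Longrightarrow> edge_free \<E> (\<pi> ` e, {d \<in> edges G. d \<subseteq> \<pi> ` e}) (\<Gamma> e)"
    by metis
  define \<gamma> where "\<gamma> d = \<Gamma> (SOME e. e \<in> \<H> \<and> d \<subseteq> e) (\<pi> ` d)" for d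
  have edge: "\<gamma> d = \<Gamma> e (\<pi> ` d)" if "e \<in> \<H>" "d \<subseteq> e" "\<pi> ` d \<in> edges G" for d e
  proof -
    \<comment> \<open>As \<open>2 \<le> g\<close>, two distinct hyperedges form a hyperforest and
      share at most one vertex, whereas \<open>d\<close> has two vertices with different
      images.\<close>
    have unique: "e' = e" if e': "e' \<in> \<H> \<and> d \<subseteq> e'" for e'
    proof (rule ccontr)
      assume ne: "e' \<noteq> e"
      have "card {e', e} \<le> g" using \<open>2 \<le> g\<close> ne by simp
      moreover have "{e', e} \<subseteq> \<H>" using e' \<open>e \<in> \<H>\<close> by simp
      ultimately have "hyperforest {e', e}" using assms(7) by (simp add: sparse_def)
      then obtain v where "e' \<inter> e \<subseteq> {v}"
        using hyperforest_Int_subset_singleton[of "{e', e}" e' e] ne by auto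
      then have "\<pi> ` d \<subseteq> {\<pi> v}" using e' \<open>d \<subseteq> e\<close> by blast
      moreover obtain x y where "x \<noteq> y" "\<pi> ` d = {x, y}"
        using assms(2) \<open>\<pi> ` d \<in> edges G\<close> unfolding is_graph_def by blast
      ultimately show False by auto
    qed
    have "(SOME e. e \<in> \<H> \<and> d \<subseteq> e) = e"
      by (rule some_equality[OF _ unique]) (use that in simp)
    then show ?thesis by (simp add: \<gamma>_def)
  qed
  have "edge_free \<E> (pullback_graph G \<pi> {e}) \<gamma>" if e: "e \<in> \<H>" for e
    unfolding edge_free_def
  proof clarify
    fix H \<theta> h
    assume H: "(H, \<theta>) \<in> \<E>" "is_hom h H (pullback_graph G \<pi> {e})"
      "\<forall>x y. {x, y} \<in> edges H \<longrightarrow> \<gamma> {h x, h y} = \<theta> {x, y}"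
    have hE: "{h x, h y} \<subseteq> e \<and> \<pi> ` {h x, h y} \<in> edges G" if "{x, y} \<in> edges H" for x y
      using H(2) that by (simp add: is_hom_def)
    have "is_hom (\<pi> \<circ> h) H (\<pi> ` e, {d \<in> edges G. d \<subseteq> \<pi> ` e})"
      using H(2) hE by (auto simp: is_hom_def verts_def[of "(_, _)"] edges_def[of "(_, _)"])
    moreover have "\<forall>x y. {x, y} \<in> edges H \<longrightarrow> \<Gamma> e {(\<pi> \<circ> h) x, (\<pi> \<circ> h) y} = \<theta> {x, y}"
    proof (intro allI impI)
      fix x y assume xy: "{x, y} \<in> edges H"
      then show "\<Gamma> e {(\<pi> \<circ> h) x, (\<pi> \<circ> h) y} = \<theta> {x, y}"
        using edge[OF e, of "{h x, h y}"] hE[OF xy] H(3) by simp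
    qed
    ultimately show False using \<Gamma>[OF e] H(1) unfolding edge_free_def by blast
  qed
  moreover have "edge_free \<E> ({}, {}) \<gamma>"
  proof -
    obtain \<gamma>' where "edge_free \<E> ({}, {}) \<gamma>'" using assms(3) by (auto simp: ECol_def)
    moreover have "{x, y} \<notin> edges H" if "is_hom h H ({}, {})" for x y h H
      using that by (simp add: is_hom_def edges_def[of "(_, _)"])
    ultimately show ?thesis unfolding edge_free_def by blast
  qed
  ultimately have "edge_free \<E> (pullback_graph G \<pi> \<H>) \<gamma>"
    using edge_free_pullback_sparse[OF assms(1,2) _ bound assms(7,8)] by blast
  then show ?thesis using is_graph_pullback_graph[OF assms(2,6,8)] by (auto simp: ECol_def)
qed

text \<open>A forbidden homomorphism into \<open>G\<close> has an image of at most \<open>K\<close>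
  vertices. It lifts along \<open>\<pi>\<close> to a hyperedge over this image whose vertices have
  the chosen colours of their parts, so it becomes forbidden in the pullback graph.\<close>

lemma in_VCol_if_pullback_in_VCol:
  fixes \<F> :: "(graph \<times> (nat \<Rightarrow> 'd)) set"
  assumes G: "is_graph G" and bound: "\<forall>(H, \<phi>)\<in>\<F>. is_graph H \<and> card (verts H) \<le> K"
    and ramsey: "partite_ramsey TYPE('d) g {S. S \<subseteq> verts G \<and> card S \<le> K} (verts G) \<pi> \<H>"
    and col: "pullback_graph G \<pi> \<H> \<in> VCol \<F>"
  shows "G \<in> VCol \<F>"
proof -
  obtain \<chi> where \<chi>: "vertex_free \<F> (pullback_graph G \<pi> \<H>) \<chi>" using col by (auto simp: VCol_def)
  have "\<exists>c. \<forall>S\<in>{S. S \<subseteq> verts G \<and> card S \<le> K}. \<exists>e\<in>\<H>. \<pi> ` e = S \<and>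
      (\<forall>x\<in>e. \<pi> x \<in> verts G \<longrightarrow> \<chi> x = c (\<pi> x))"
    using ramsey by (simp only: partite_ramsey_def)
  then obtain c where c: "\<forall>S\<in>{S. S \<subseteq> verts G \<and> card S \<le> K}. \<exists>e\<in>\<H>. \<pi> ` e = S \<and>
      (\<forall>x\<in>e. \<pi> x \<in> verts G \<longrightarrow> \<chi> x = c (\<pi> x))" ..
  have "vertex_free \<F> G c"
    unfolding vertex_free_def
  proof clarify
    fix H \<phi> h
    assume H: "(H, \<phi>) \<in> \<F>" "is_hom h H G" "\<forall>x\<in>verts H. c (h x) = \<phi> x"
    have gH: "is_graph H" and le: "card (verts H) \<le> K" using bound H(1) by auto
    have sub: "h ` verts H \<subseteq> verts G" using H(2) by (auto simp: is_hom_def)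
    moreover have "card (h ` verts H) \<le> K"
      using gH le card_image_le[of "verts H" h] by (simp add: is_graph_def)
    ultimately have "h ` verts H \<in> {S. S \<subseteq> verts G \<and> card S \<le> K}" by simp
    from bspec[OF c this] obtain e where e: "e \<in> \<H>" "\<pi> ` e = h ` verts H"
        "\<forall>x\<in>e. \<pi> x \<in> verts G \<longrightarrow> \<chi> x = c (\<pi> x)" by auto
    define h' where "h' x = inv_into e \<pi> (h x)" for x
    have h': "h' x \<in> e" "\<pi> (h' x) = h x" if "x \<in> verts H" for x
    proof -
      have "h x \<in> \<pi> ` e" using that e(2) by blast
      then show "h' x \<in> e" "\<pi> (h' x) = h x"
        unfolding h'_def by (auto intro: inv_into_into f_inv_into_f)
    qed
    have "is_hom h' H (pullback_graph G \<pi> \<H>)"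
      unfolding is_hom_def
    proof (intro conjI ballI allI impI)
      show "h' x \<in> verts (pullback_graph G \<pi> \<H>)" if "x \<in> verts H" for x
        using h'(1)[OF that] e(1) by auto
      show "{h' x, h' y} \<in> edges (pullback_graph G \<pi> \<H>)" if xy: "{x, y} \<in> edges H" for x y
      proof -
        have "{h x, h y} \<in> edges G" using H(2) xy by (simp add: is_hom_def)
        then show ?thesis using h' is_graph_edge_verts[OF gH xy] e(1) by auto
      qed
    qed
    moreover have "\<forall>x\<in>verts H. \<chi> (h' x) = \<phi> x" using e(3) h' H(3) sub by auto
    ultimately show False using \<chi> H(1) unfolding vertex_free_def by blast
  qed
  then show ?thesis using G by (auto simp: VCol_def)
qed

theorem theorem4:
  fixes \<E> :: "(graph \<times> (nat set \<Rightarrow> 'c::finite)) set"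
  assumes "finite \<E>"
    and "\<forall>(H, \<theta>)\<in>\<E>. is_graph H"
    and "amalg_closed \<E>"
    and "\<forall>K::nat. K \<ge> 1 \<longrightarrow> (\<exists>G. is_graph G \<and> G \<notin> ECol \<E> \<and>
           (\<forall>H. is_subgraph H G \<and> card (verts H) \<le> K \<longrightarrow> H \<in> ECol \<E>))"
  shows "\<not> (\<exists>\<F> :: (graph \<times> (nat \<Rightarrow> 'd::finite)) set.
            finite \<F> \<and> (\<forall>(H, \<phi>)\<in>\<F>. is_graph H) \<and> VCol \<F> = ECol \<E>)"
proof (rule notI, elim exE conjE)
  fix \<F> :: "(graph \<times> (nat \<Rightarrow> 'd)) set"
  assume \<F>: "finite \<F>" "\<forall>(H, \<phi>)\<in>\<F>. is_graph H" "VCol \<F> = ECol \<E>"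
  \<comment> \<open>\<open>Suc\<close> secures \<open>K \<ge> 1\<close> even if the sum
    vanishes.\<close>
  define K where "K = Suc (\<Sum>(H, \<phi>)\<in>\<F>. card (verts H))"
  \<comment> \<open>The summand 2 ensures that two hyperedges share at most one vertex; the sum
    bounds the number of hyperedges needed to cover an image.\<close>
  define g where "g = 2 + (\<Sum>(H, \<theta>)\<in>\<E>. card (verts H) + card (edges H))"
  have K: "\<forall>(H, \<phi>)\<in>\<F>. is_graph H \<and> card (verts H) \<le> K"
    using \<F>(1,2) member_le_sum[of _ \<F> "\<lambda>(H, \<phi>). card (verts H)"] by (fastforce simp: K_def)
  have g: "\<forall>(H, \<theta>)\<in>\<E>. is_graph H \<and> card (verts H) + card (edges H) \<le> g"
    using assms(1,2) member_le_sum[of _ \<E> "\<lambda>(H, \<theta>). card (verts H) + card (edges H)"]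
    by (fastforce simp: g_def)
  obtain G where G: "is_graph G" "G \<notin> ECol \<E>"
      "\<And>H. is_subgraph H G \<Longrightarrow> card (verts H) \<le> K \<Longrightarrow> H \<in> ECol \<E>"
    using assms(4)[rule_format, of K] by (auto simp: K_def)
  have small: "(S, {d \<in> edges G. d \<subseteq> S}) \<in> ECol \<E>" if "S \<subseteq> verts G" "card S \<le> K" for S
  proof (rule G(3))
    show "card (verts (S, {d \<in> edges G. d \<subseteq> S})) \<le> K" using that by (simp add: verts_def)
    have "finite S" using that G(1) by (auto simp: is_graph_def intro: finite_subset)
    then show "is_subgraph (S, {d \<in> edges G. d \<subseteq> S}) G"
      using that G(1)
      by (fastforce simp: is_subgraph_def is_graph_def verts_def[of "(_, _)"] edges_def[of "(_, _)"])
  qed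
  have no_edge: "{d \<in> edges G. d \<subseteq> {}} = {}" using G(1) by (auto simp: is_graph_def)
  \<comment> \<open>The empty graph starts the induction over hyperforests; it is colourable as the
    case \<open>S = {}\<close> of \<open>small\<close>.\<close>
  have empty: "({}, {}) \<in> ECol \<E>" using small[of "{}"] unfolding no_edge by simp
  have "finite (verts G)" using G(1) by (simp add: is_graph_def)
  then obtain \<pi> \<H> where
    ramsey: "partite_ramsey TYPE('d) g {S. S \<subseteq> verts G \<and> card S \<le> K} (verts G) \<pi> \<H>"
    using partite_ramsey_exists[of "verts G" "{S. S \<subseteq> verts G \<and> card S \<le> K}"] by blast
  then have "pullback_graph G \<pi> \<H> \<in> ECol \<E>"
    using assms(3) G(1) empty g small
    by (intro pullback_sparse_in_ECol[where g = g]) (auto simp: partite_ramsey_def g_def)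
  then have "G \<in> VCol \<F>" using in_VCol_if_pullback_in_VCol[OF G(1) K ramsey] \<F>(3) by blast
  then show False using G(2) \<F>(3) by blast
qed

end
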